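(* Let $\alpha=(\alpha_n)_{n\ge1}$ be a strictly increasing, positive, finitely nuclear sequence which is unstable. Then $\Delta(\mathcal{K}_{\alpha})=\Delta\big(\Lambda_{1}((\alpha_{n+1})_{n\ge0})\big)$.
   Context: **Power series spaces of finite type.** For a non-negative increasing sequence $\beta=(\beta_n)_{n\ge n_0}$ (indexed from $n_0=0$ or $n_0=1$) with $\beta_n\to+\infty$, $\Lambda_1(\beta)=\{x=(x_n)_{n\ge n_0}:\|x\|_k=\sum_n|x_n|e^{-\beta_n/k}<\infty\ \forall k\ge1\}$. In particular $(\alpha_{n+1})_{n\ge0}=(\alpha_1,\alpha_2,\dots)$ is the sequence $\alpha$ re-indexed from $0$. The sequence $\alpha$ is finitely nuclear if $\Lambda_1(\alpha)$ is nuclear, equivalently $\lim_n\ln(n)/\alpha_n=0$. It is unstable if $\lim_n\alpha_{n+1}/\alpha_n=+\infty$. **The space $\mathcal K_\alpha$.** For $s\in\{1,2,\dots\}$ let $I_s=\{\frac{s(s+1)}2+ys+\frac{y(y-1)}2:\ y=0,1,2,\dots\}$. The sets $I_s$ are infinite, pairwise disjoint, and their union is $\{1,2,3,\dots\}$. For $k,n\ge1$ with $n\in I_s$ put $$a_{k,n}=\begin{cases}e^{-\frac1k\alpha_n},&k\le s,\\ e^{(-\frac1k+1)\alpha_n},&k\ge s+1.\end{cases}$$ Then $\mathcal K_\alpha=\{x=(x_n)_{n\ge1}:\|x\|_k=\sum_n|x_n|a_{k,n}<\infty\ \forall k\ge1\}$, a Fréchet space with the seminorms $\|\cdot\|_k$.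 **Diameters.** For absolutely convex sets $U,V$ in a Fréchet space $E$ with $V\subseteq CU$ for some $C>0$, the $n$-th Kolmogorov diameter ($n=0,1,2,\dots$) is $d_n(V,U)=\inf\{t>0:\ V\subseteq tU+L \text{ for some linear subspace } L\subseteq E,\ \dim L\le n\}$. **Diametral dimension.** For a Fréchet space $E$ with increasing fundamental seminorms $\|\cdot\|_k$ and $U_k=\{x:\|x\|_k\le1\}$, $$\Delta(E)=\{(t_n)_{n\ge0}:\forall p\ \exists q>p\ \lim_n t_nd_n(U_q,U_p)=0\}.$$ *)

theory Defs
  imports "HOL-Analysis.Analysis" "HOL-Library.Function_Algebras"
begin

text \<open>
  A Frechet space is represented by its carrier (a linear subspace of an ambient vector space with
  scalar multiplication \<open>smul\<close>) together with an increasing fundamental system of seminorms; only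
  the seminorms with index \<open>k \<ge> 1\<close> are meaningful.
\<close>

record 'v graded_space =
  points :: "'v set"
  seminorm :: "nat \<Rightarrow> 'v \<Rightarrow> real"

definition unit_ball :: "'v graded_space \<Rightarrow> nat \<Rightarrow> 'v set" where
  "unit_ball E k = {x \<in> points E. seminorm E k x \<le> 1}"

text \<open>
  The constant \<open>vector_space.dim\<close> is 0 on infinite-dimensional subspaces, so \<open>dim L \<le> n\<close> is
  expressed through a finite basis.
\<close>

definition subspace_dim_le ::
    "('k::field \<Rightarrow> 'v::ab_group_add \<Rightarrow> 'v) \<Rightarrow> 'v set \<Rightarrow> nat \<Rightarrow> bool" where
  "subspace_dim_le smul L n \<longleftrightarrow>
     module.subspace smul L \<and>
     (\<exists>B. finite B \<and> card B \<le> n \<and> \<not> module.dependent smul B \<and> module.span smul B = L)"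

text \<open>This is only meaningful if \<open>V \<subseteq> C U\<close> for some \<open>C > 0\<close>.\<close>

definition kolmogorov_diameter ::
    "('k::real_normed_field \<Rightarrow> 'v::ab_group_add \<Rightarrow> 'v) \<Rightarrow> 'v set \<Rightarrow> nat \<Rightarrow> 'v set \<Rightarrow> 'v set \<Rightarrow> real" where
  "kolmogorov_diameter smul E n V U =
     Inf {t. t > 0 \<and> (\<exists>L \<subseteq> E. subspace_dim_le smul L n \<and>
                V \<subseteq> {smul (of_real t) u + l | u l. u \<in> U \<and> l \<in> L})}"

definition diametral_dimension ::
    "('k::real_normed_field \<Rightarrow> 'v::ab_group_add \<Rightarrow> 'v) \<Rightarrow> 'v graded_space \<Rightarrow> (nat \<Rightarrow> 'k) set" where
  "diametral_dimension smul E =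
     {t. \<forall>p\<ge>1. \<exists>q>p.
        (\<lambda>n. t n * of_real (kolmogorov_diameter smul (points E) n (unit_ball E q) (unit_ball E p)))
          \<longlonglongrightarrow> 0}"

text \<open>
  Nuclearity: for every \<open>p\<close> there is \<open>q > p\<close> such that the canonical map between the local Banach
  spaces \<open>E\<^sub>q \<rightarrow> E\<^sub>p\<close> is nuclear, that is, of the form \<open>x \<mapsto> \<Sum>j. f\<^sub>j(x) y\<^sub>j\<close> with
  \<open>\<Sum>j. \<parallel>f\<^sub>j\<parallel> \<parallel>y\<^sub>j\<parallel> < \<infinity>\<close>. The number \<open>c j\<close> is a bound for the dual norm of \<open>f\<^sub>j\<close>. The \<open>y\<^sub>j\<close> may be taken in
  the space itself instead of the completion \<open>E\<^sub>p\<close>, since every element \<open>z\<close> of the completion is the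
  sum of a series of points of the space whose norms sum up to at most \<open>2 \<parallel>z\<parallel>\<close>.
\<close>

definition nuclear ::
    "('k::real_normed_field \<Rightarrow> 'v::ab_group_add \<Rightarrow> 'v) \<Rightarrow> 'v graded_space \<Rightarrow> bool" where
  "nuclear smul E \<longleftrightarrow>
     (\<forall>p\<ge>1. \<exists>q>p. \<exists>(f :: nat \<Rightarrow> 'v \<Rightarrow> 'k) (y :: nat \<Rightarrow> 'v) (c :: nat \<Rightarrow> real).
        (\<forall>j. \<forall>u\<in>points E. \<forall>v\<in>points E. f j (u + v) = f j u + f j v) \<and>
        (\<forall>j r. \<forall>u\<in>points E. f j (smul r u) = r * f j u) \<and>
        (\<forall>j. 0 \<le> c j \<and> (\<forall>u\<in>points E. norm (f j u) \<le> c j * seminorm E q u)) \<and>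
        (\<forall>j. y j \<in> points E) \<and>
        summable (\<lambda>j. c j * seminorm E p (y j)) \<and>
        (\<forall>u\<in>points E. (\<lambda>N. seminorm E p (u - (\<Sum>j<N. smul (f j u) (y j)))) \<longlonglongrightarrow> 0))"

definition seq_scale :: "'k::real_normed_field \<Rightarrow> (nat \<Rightarrow> 'k) \<Rightarrow> (nat \<Rightarrow> 'k)" where
  "seq_scale r x = (\<lambda>n. r * x n)"

text \<open>
  Sequences \<open>(x\<^sub>n)\<close> with \<open>n \<ge> n0\<close> are encoded as functions on all natural numbers that vanish below \<open>n0\<close>.
\<close>

definition koethe_space ::
    "nat \<Rightarrow> (nat \<Rightarrow> nat \<Rightarrow> real) \<Rightarrow> (nat \<Rightarrow> 'k::real_normed_field) graded_space" where
  "koethe_space n0 a =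
     \<lparr> points = {x. (\<forall>n<n0. x n = 0) \<and> (\<forall>k\<ge>1. (\<lambda>n. norm (x n) * a k n) summable_on {n0..})},
       seminorm = (\<lambda>k x. \<Sum>\<^sub>\<infinity>n\<in>{n0..}. norm (x n) * a k n) \<rparr>"

definition Lambda1 :: "nat \<Rightarrow> (nat \<Rightarrow> real) \<Rightarrow> (nat \<Rightarrow> 'k::real_normed_field) graded_space" where
  "Lambda1 n0 \<beta> = koethe_space n0 (\<lambda>k n. exp (- \<beta> n / real k))"

definition I_block :: "nat \<Rightarrow> nat set" where
  "I_block s = {s * (s + 1) div 2 + y * s + y * (y - 1) div 2 | y. True}"

definition block_of :: "nat \<Rightarrow> nat" where
  "block_of n = (THE s. s \<ge> 1 \<and> n \<in> I_block s)"

definition K_weight :: "(nat \<Rightarrow> real) \<Rightarrow> nat \<Rightarrow> nat \<Rightarrow> real" where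
  "K_weight \<alpha> k n =
     (if k \<le> block_of n then exp (- (1 / real k) * \<alpha> n) else exp ((- (1 / real k) + 1) * \<alpha> n))"

definition K_space :: "(nat \<Rightarrow> real) \<Rightarrow> (nat \<Rightarrow> 'k::real_normed_field) graded_space" where
  "K_space \<alpha> = koethe_space 1 (K_weight \<alpha>)"

definition unstable :: "(nat \<Rightarrow> real) \<Rightarrow> bool" where
  "unstable \<alpha> \<longleftrightarrow> filterlim (\<lambda>n. \<alpha> (n + 1) / \<alpha> n) at_top sequentially"

lemma vector_space_seq_scale: "vector_space seq_scale"
  by unfold_locales (auto simp: seq_scale_def fun_eq_iff algebra_simps)

text \<open>The blocks with \<open>s \<ge> 1\<close> partition the positive integers, so \<^const>\<open>block_of\<close> is well defined.\<close>

lemma I_block_element: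
  fixes s y :: nat
  assumes "s \<ge> 1"
  shows "s * (s + 1) div 2 + y * s + y * (y - 1) div 2 = (s + y) * (s + y - 1) div 2 + s"
proof -
  have e: "even (s * (s + 1))" "even (y * (y - 1))" "even ((s + y) * (s + y - 1))"
    by auto
  obtain s' where s: "s = Suc s'" using assms by (cases s) auto
  have "2 * (s * (s + 1) div 2 + y * s + y * (y - 1) div 2) = s * (s + 1) + 2 * y * s + y * (y - 1)"
    unfolding distrib_left dvd_mult_div_cancel[OF e(1), unfolded distrib_left]
      dvd_mult_div_cancel[OF e(2)] by simp
  also have "\<dots> = (s + y) * (s + y - 1) + 2 * s"
    by (cases y) (auto simp: s algebra_simps)
  also have "\<dots> = 2 * ((s + y) * (s + y - 1) div 2 + s)"
    unfolding distrib_left[of 2] dvd_mult_div_cancel[OF e(3)] ..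
  finally show ?thesis by simp
qed

lemma triangular_step: "Suc d * d div 2 = d * (d - 1) div 2 + d"
proof (cases d)
  case (Suc m)
  have "Suc d * d = d * (d - 1) + d * 2" by (simp add: Suc algebra_simps)
  then show ?thesis by simp
qed simp

lemma triangular_mono:
  fixes d d' :: nat
  shows "d < d' \<Longrightarrow> d * (d - 1) div 2 + d \<le> d' * (d' - 1) div 2"
proof (induction d')
  case (Suc d')
  then show ?case using triangular_step[of d'] by (cases "d = d'") auto
qed simp

lemma I_block_disjoint:
  assumes "s \<ge> 1" "s' \<ge> 1" "n \<in> I_block s" "n \<in> I_block s'"
  shows "s = s'"
proof -
  obtain y y' where n: "n = (s + y) * (s + y - 1) div 2 + s" "n = (s' + y') * (s' + y' - 1) div 2 + s'"
    using assms(3,4) I_block_element[OF assms(1)] I_block_element[OF assms(2)]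
    unfolding I_block_def by (smt (verit) mem_Collect_eq)
  then show ?thesis
    using triangular_mono[of "s + y" "s' + y'"] triangular_mono[of "s' + y'" "s + y"] assms
    by (cases "s + y" "s' + y'" rule: linorder_cases) auto
qed

lemma I_block_cover:
  assumes "n \<ge> 1"
  shows "\<exists>s\<ge>1. n \<in> I_block s"
proof -
  have "\<exists>d s. s \<ge> 1 \<and> s \<le> d \<and> n = d * (d - 1) div 2 + s"
    using assms
  proof (induction n rule: nat_induct_at_least)
    case base
    show ?case by (rule exI[of _ 1], rule exI[of _ 1]) simp
  next
    case (Suc n)
    then obtain d s where ds: "s \<ge> 1" "s \<le> d" "n = d * (d - 1) div 2 + s" by auto
    show ?case
    proof (cases "s = d")
      case True
      then show ?thesis using ds triangular_step[of d]
        by (intro exI[of _ "Suc d"] exI[of _ 1]) auto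
    next
      case False
      then show ?thesis using ds by (intro exI[of _ d] exI[of _ "Suc s"]) auto
    qed
  qed
  then obtain d s where ds: "s \<ge> 1" "s \<le> d" "n = d * (d - 1) div 2 + s" by auto
  then have "n = s * (s + 1) div 2 + (d - s) * s + (d - s) * ((d - s) - 1) div 2"
    using I_block_element[of s "d - s"] by simp
  then show ?thesis using ds unfolding I_block_def by blast
qed

lemma block_of_eq: "s \<ge> 1 \<Longrightarrow> n \<in> I_block s \<Longrightarrow> block_of n = s"
  unfolding block_of_def using I_block_disjoint by blast

end

theory Submission
  imports Defs
begin

text \<open>
  The Kolmogorov diameters of the unit balls of a weighted \<open>\<ell>\<^sup>1\<close> sequence space are governed by
  the quotients \<open>a\<^sub>p(i) / a\<^sub>q(i)\<close> of the weights: \<open>d\<^sub>n(U\<^sub>q, U\<^sub>p)\<close> is at most \<open>t\<close> if all but \<open>n\<close> quotients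
  are at most \<open>t\<close> (\<open>koethe_diameter_le\<close>), and at least \<open>t\<close> if \<open>n + 1\<close> of them are
  at least \<open>t\<close> (\<open>koethe_diameter_ge\<close>). Put \<open>\<epsilon>\<^sub>p\<^sub>q = 1/p - 1/q\<close>. For \<open>\<Lambda>\<^sub>1\<close> of the shifted sequence, the
  quotients decrease and \<open>d\<^sub>n = exp (- \<epsilon>\<^sub>p\<^sub>q \<alpha>\<^sub>n\<^sub>+\<^sub>1)\<close>. For \<open>\<K>\<^sub>\<alpha>\<close>, the quotient at \<open>i\<close> is also
  \<open>exp (- \<epsilon>\<^sub>p\<^sub>q \<alpha>\<^sub>i)\<close>, except that it has the additional factor \<open>exp (- \<alpha>\<^sub>i)\<close> if \<open>i\<close> belongs to a block
  \<open>I\<^sub>s\<close> with \<open>p \<le> s < q\<close>.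

  So the diameters of \<open>\<K>\<^sub>\<alpha>\<close> are at most those of \<open>\<Lambda>\<^sub>1\<close>, which gives one inclusion. For the other one,
  instability makes \<open>\<alpha>\<^sub>n\<^sub>+\<^sub>1\<close> so large compared with \<open>\<alpha>\<^sub>n\<close> that the additional factor does not
  disturb the order of the quotients: for large \<open>n\<close>, the \<open>(n+1)\<close>-st quotient is the smallest of the
  first \<open>n + 1\<close>. Hence \<open>d\<^sub>n(U\<^sub>q, U\<^sub>p) \<ge> exp (- \<epsilon>\<^sub>p\<^sub>q \<alpha>\<^sub>n\<^sub>+\<^sub>1)\<close> for all large \<open>n\<close> whose successor avoids the
  blocks \<open>p, \<dots>, q - 1\<close> (\<open>K_space_diameter_ge\<close>). On the avoided blocks this bound fails, but
  the definition of the diametral dimension may be applied twice: \<open>p\<close> yields some \<open>q\<close> and \<open>q\<close> yields some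
  \<open>r\<close>, and no block lies both in \<open>[p, q)\<close> and in \<open>[q, r)\<close>. For each large \<open>n\<close> one of the two diameters
  \<open>d\<^sub>n(U\<^sub>q, U\<^sub>p)\<close> and \<open>d\<^sub>n(U\<^sub>r, U\<^sub>q)\<close> of \<open>\<K>\<^sub>\<alpha>\<close> is therefore at least the diameter \<open>d\<^sub>n(U\<^sub>r, U\<^sub>p)\<close> of \<open>\<Lambda>\<^sub>1\<close>.
\<close>

section \<open>Diameters of weighted sequence spaces\<close>

abbreviation koethe_diameter ::
    "(nat \<Rightarrow> 'k::real_normed_field) graded_space \<Rightarrow> nat \<Rightarrow> nat \<Rightarrow> nat \<Rightarrow> real" where
  "koethe_diameter E n q p \<equiv>
     kolmogorov_diameter seq_scale (points E) n (unit_ball E q) (unit_ball E p)"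

lemma seminorm_koethe_space:
  "seminorm (koethe_space n0 a) k x = (\<Sum>\<^sub>\<infinity>n\<in>{n0..}. norm (x n) * a k n)"
  by (simp add: koethe_space_def)

lemma finite_support_in_points:
  assumes "finite F" "F \<subseteq> {n0..}" "\<And>i. i \<notin> F \<Longrightarrow> x i = 0"
  shows "x \<in> points (koethe_space n0 a)"
proof -
  have "(\<lambda>n. norm (x n) * a k n) summable_on {n0..}" for k
    using summable_on_finite[OF assms(1)]
    by (rule summable_on_cong_neutral[THEN iffD1, rotated -1]) (use assms in auto)
  moreover have "x n = 0" if "n < n0" for n
    using assms that by force
  ultimately show ?thesis
    by (simp add: koethe_space_def)
qed

lemma coordinate_subspace_dim_le:
  assumes "finite F" "card F \<le> n"
  shows "subspace_dim_le (seq_scale :: 'k::real_normed_field \<Rightarrow> _) {x. \<forall>i. i \<notin> F \<longrightarrow> x i = 0} n"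
proof -
  interpret V: vector_space "seq_scale :: 'k \<Rightarrow> _" by (rule vector_space_seq_scale)
  define e :: "nat \<Rightarrow> nat \<Rightarrow> 'k" where "e = (\<lambda>i j. if j = i then 1 else 0)"
  let ?L = "{x :: nat \<Rightarrow> 'k. \<forall>i. i \<notin> F \<longrightarrow> x i = 0}"
  have sub: "V.subspace ?L"
    by (auto simp: V.subspace_def seq_scale_def)
  have "?L \<subseteq> V.span (e ` F)"
  proof
    fix x assume x: "x \<in> ?L"
    have "x j = (\<Sum>i\<in>F. seq_scale (x i) (e i)) j" for j
    proof -
      have "(\<Sum>i\<in>F. seq_scale (x i) (e i)) j = (\<Sum>i\<in>F. seq_scale (x i) (e i) j)"
        using assms(1) by induction auto
      also have "\<dots> = (\<Sum>i\<in>F. if i = j then x i else 0)"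
        by (intro sum.cong) (auto simp: seq_scale_def e_def)
      also have "\<dots> = x j" using x assms(1) by auto
      finally show ?thesis by simp
    qed
    then have "x = (\<Sum>i\<in>F. seq_scale (x i) (e i))" by blast
    also have "\<dots> \<in> V.span (e ` F)"
      by (intro V.span_sum V.span_scale V.span_base) auto
    finally show "x \<in> V.span (e ` F)" .
  qed
  moreover have "V.span (e ` F) \<subseteq> ?L"
    by (rule V.span_minimal[OF _ sub]) (auto simp: e_def)
  ultimately have span: "V.span (e ` F) = ?L" by blast
  obtain B where B: "B \<subseteq> e ` F" "\<not> V.dependent B" "e ` F \<subseteq> V.span B"
    using V.maximal_independent_subset[of "e ` F"] by blast
  have "V.span B = ?L"
    using B V.span_mono[OF B(1)] V.span_minimal[OF B(3)] span by auto
  moreover have "finite B" using B(1) assms(1) finite_subset by blast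
  moreover have "card B \<le> n"
    using card_mono[OF _ B(1)] card_image_le[OF assms(1), of e] assms by auto
  ultimately show ?thesis
    using sub B(2) unfolding subspace_dim_le_def by blast
qed

text \<open>
  Cutting off the coordinates in \<open>F\<close> costs \<open>card F\<close> dimensions, and the quotients of the weights
  bound what remains.
\<close>

lemma koethe_ball_cover:
  fixes a :: "nat \<Rightarrow> nat \<Rightarrow> real"
  assumes "p \<ge> 1" "q \<ge> 1" and F: "finite F" "F \<subseteq> {n0..}" "card F \<le> n" and "t > 0"
    and nonneg: "\<And>k i. i \<ge> n0 \<Longrightarrow> a k i \<ge> 0"
    and le: "\<And>i. i \<ge> n0 \<Longrightarrow> i \<notin> F \<Longrightarrow> a p i \<le> t * a q i"
  shows "\<exists>L \<subseteq> points (koethe_space n0 a). subspace_dim_le (seq_scale :: 'k::real_normed_field \<Rightarrow> _) L n \<and>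
           unit_ball (koethe_space n0 a) q
             \<subseteq> {seq_scale (of_real t) u + l | u l. u \<in> unit_ball (koethe_space n0 a) p \<and> l \<in> L}"
proof -
  let ?E = "koethe_space n0 a :: (nat \<Rightarrow> 'k) graded_space"
  define L where "L = {x :: nat \<Rightarrow> 'k. \<forall>i. i \<notin> F \<longrightarrow> x i = 0}"
  have "L \<subseteq> points ?E"
    using finite_support_in_points[OF F(1,2)] by (auto simp: L_def)
  moreover have "subspace_dim_le seq_scale L n"
    unfolding L_def by (rule coordinate_subspace_dim_le[OF F(1,3)])
  moreover have "\<exists>u l. x = seq_scale (of_real t) u + l \<and> u \<in> unit_ball ?E p \<and> l \<in> L"
    if x: "x \<in> unit_ball ?E q" for x
  proof -
    define l where "l = (\<lambda>i. if i \<in> F then x i else 0)"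
    define u where "u = (\<lambda>i. if i \<in> F then 0 else x i / of_real t)"
    have x0: "x i = 0" if "i < n0" for i
      using x that by (auto simp: unit_ball_def koethe_space_def)
    have xs: "(\<lambda>i. norm (x i) * a k i) summable_on {n0..}" if "k \<ge> 1" for k
      using x that by (auto simp: unit_ball_def koethe_space_def)
    have x1: "(\<Sum>\<^sub>\<infinity>i\<in>{n0..}. norm (x i) * a q i) \<le> 1"
      using x by (auto simp: unit_ball_def koethe_space_def)
    have us: "(\<lambda>i. norm (u i) * a k i) summable_on {n0..}" if "k \<ge> 1" for k
    proof (rule summable_on_comparison_test)
      show "(\<lambda>i. (1 / t) * (norm (x i) * a k i)) summable_on {n0..}"
        by (intro summable_on_cmult_right xs that)
      show "norm (u i) * a k i \<le> (1 / t) * (norm (x i) * a k i)" if "i \<in> {n0..}" for i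
        using that nonneg \<open>t > 0\<close> by (auto simp: u_def norm_divide)
      show "0 \<le> norm (u i) * a k i" if "i \<in> {n0..}" for i
        using that nonneg by auto
    qed
    have "(\<Sum>\<^sub>\<infinity>i\<in>{n0..}. norm (u i) * a p i) \<le> (\<Sum>\<^sub>\<infinity>i\<in>{n0..}. norm (x i) * a q i)"
    proof (rule infsum_mono[OF us[OF \<open>p \<ge> 1\<close>] xs[OF \<open>q \<ge> 1\<close>]])
      fix i assume i: "i \<in> {n0..}"
      show "norm (u i) * a p i \<le> norm (x i) * a q i"
      proof (cases "i \<in> F")
        case True
        then show ?thesis using i nonneg by (auto simp: u_def)
      next
        case False
        then have "a p i / t \<le> a q i"
          using le[of i] i \<open>t > 0\<close> by (simp add: field_simps)
        then have "norm (x i) * (a p i / t) \<le> norm (x i) * a q i"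
          by (intro mult_left_mono) auto
        then show ?thesis using False \<open>t > 0\<close> by (simp add: u_def norm_divide)
      qed
    qed
    with x1 have "u \<in> unit_ball ?E p"
      using us x0 by (auto simp: unit_ball_def koethe_space_def u_def)
    moreover have "x = seq_scale (of_real t) u + l"
      using \<open>t > 0\<close> by (auto simp: fun_eq_iff seq_scale_def u_def l_def)
    moreover have "l \<in> L" by (auto simp: L_def l_def)
    ultimately show ?thesis by blast
  qed
  ultimately show ?thesis
    by (intro exI[of _ L]) blast
qed

lemma koethe_diameter_le:
  fixes a :: "nat \<Rightarrow> nat \<Rightarrow> real"
  assumes "p \<ge> 1" "q \<ge> 1" "finite F" "F \<subseteq> {n0..}" "card F \<le> n" "t > 0"
    and "\<And>k i. i \<ge> n0 \<Longrightarrow> a k i \<ge> 0"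
    and "\<And>i. i \<ge> n0 \<Longrightarrow> i \<notin> F \<Longrightarrow> a p i \<le> t * a q i"
  shows "koethe_diameter (koethe_space n0 a :: (nat \<Rightarrow> 'k::real_normed_field) graded_space) n q p \<le> t"
  unfolding kolmogorov_diameter_def
proof (rule cInf_lower)
  show "t \<in> {t. t > 0 \<and> (\<exists>L \<subseteq> points (koethe_space n0 a). subspace_dim_le (seq_scale :: 'k \<Rightarrow> _) L n \<and>
           unit_ball (koethe_space n0 a) q
             \<subseteq> {seq_scale (of_real t) u + l | u l. u \<in> unit_ball (koethe_space n0 a) p \<and> l \<in> L})}"
    using assms by (intro CollectI conjI koethe_ball_cover)
qed (auto intro: bdd_belowI[of _ 0])

lemma underdetermined_linear_system:
  fixes f :: "'b \<Rightarrow> 'i \<Rightarrow> 'k::field"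
  assumes "finite B" "finite F" "card B < card F"
  shows "\<exists>\<phi>. (\<exists>i\<in>F. \<phi> i \<noteq> 0) \<and> (\<forall>b\<in>B. (\<Sum>i\<in>F. \<phi> i * f b i) = 0)"
  using assms
proof (induction B arbitrary: F f rule: finite_induct)
  case empty
  then have "F \<noteq> {}" by auto
  then show ?case by (intro exI[of _ "\<lambda>_. 1"]) auto
next
  case (insert b B)
  show ?case
  proof (cases "\<forall>i\<in>F. f b i = 0")
    case True
    then show ?thesis using insert.IH[of F f] insert.prems insert.hyps by auto
  next
    case False
    then obtain k where k: "k \<in> F" "f b k \<noteq> 0" by blast
    \<comment> \<open>Gaussian elimination: equation \<open>b\<close> removes the unknown with index \<open>k\<close> from the other equations.\<close>
    define g where "g = (\<lambda>c i. f c i - f c k / f b k * f b i)"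
    have "card B < card (F - {k})"
      using insert.prems insert.hyps k by simp
    then obtain \<psi> where \<psi>: "\<exists>i\<in>F - {k}. \<psi> i \<noteq> 0" "\<And>c. c \<in> B \<Longrightarrow> (\<Sum>i\<in>F - {k}. \<psi> i * g c i) = 0"
      using insert.IH[of "F - {k}" g] insert.prems by auto
    define S where "S = (\<lambda>c. \<Sum>i\<in>F - {k}. \<psi> i * f c i)"
    define \<phi> where "\<phi> = \<psi>(k := - S b / f b k)"
    have sum: "(\<Sum>i\<in>F. \<phi> i * f c i) = - S b / f b k * f c k + S c" for c
    proof -
      have "(\<Sum>i\<in>F. \<phi> i * f c i) = \<phi> k * f c k + (\<Sum>i\<in>F - {k}. \<phi> i * f c i)"
        by (rule sum.remove[OF insert.prems(1) k(1)])
      also have "(\<Sum>i\<in>F - {k}. \<phi> i * f c i) = S c"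
        unfolding S_def by (intro sum.cong) (auto simp: \<phi>_def)
      finally show ?thesis by (simp add: \<phi>_def)
    qed
    have "S c = f c k / f b k * S b" if "c \<in> B" for c
    proof -
      have "0 = (\<Sum>i\<in>F - {k}. \<psi> i * f c i - f c k / f b k * (\<psi> i * f b i))"
        using \<psi>(2)[OF that] by (simp add: g_def algebra_simps)
      also have "\<dots> = S c - f c k / f b k * S b"
        unfolding S_def sum_subtractf sum_distrib_left ..
      finally show ?thesis by simp
    qed
    then have "(\<Sum>i\<in>F. \<phi> i * f c i) = 0" if "c \<in> insert b B" for c
      using that k(2) unfolding sum by auto
    moreover have "\<exists>i\<in>F. \<phi> i \<noteq> 0" using \<psi>(1) by (auto simp: \<phi>_def)
    ultimately show ?thesis by blast
  qed
qed

text \<open>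
  Duality: if \<open>dim L \<le> n\<close>, some nonzero functional \<open>\<phi>\<close> that depends on the \<open>n + 1\<close>
  coordinates in \<open>F\<close> only vanishes on \<open>L\<close>. The dual norm of \<open>\<phi>\<close> for \<open>\<parallel>\<cdot>\<parallel>\<^sub>p\<close> is the maximum of
  \<open>\<bar>\<phi>\<^sub>i\<bar> / a\<^sub>p(i)\<close>. If the maximum is attained at \<open>m\<close>, testing the inclusion of the balls with the
  multiple of the \<open>m\<close>-th unit vector of \<open>q\<close>-norm 1 gives \<open>a\<^sub>p(m) / a\<^sub>q(m) \<le> t\<close>. The monotonicity
  of the weights makes the infimum in the definition of the diameter run over a nonempty set.
\<close>

lemma koethe_diameter_ge:
  fixes a :: "nat \<Rightarrow> nat \<Rightarrow> real"
  assumes "p \<ge> 1" "q \<ge> 1" and F: "finite F" "F \<subseteq> {n0..}" "card F = Suc n"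
    and pos: "\<And>k i. i \<ge> n0 \<Longrightarrow> a k i > 0"
    and mono: "\<And>i. i \<ge> n0 \<Longrightarrow> a p i \<le> a q i"
    and ge: "\<And>i. i \<in> F \<Longrightarrow> t * a q i \<le> a p i"
  shows "t \<le> koethe_diameter (koethe_space n0 a :: (nat \<Rightarrow> 'k::real_normed_field) graded_space) n q p"
  unfolding kolmogorov_diameter_def
proof (rule cInf_greatest)
  let ?E = "koethe_space n0 a :: (nat \<Rightarrow> 'k) graded_space"
  interpret V: vector_space "seq_scale :: 'k \<Rightarrow> _" by (rule vector_space_seq_scale)
  have "\<exists>L \<subseteq> points ?E. subspace_dim_le seq_scale L n \<and>
      unit_ball ?E q \<subseteq> {seq_scale (of_real 1) u + l | u l. u \<in> unit_ball ?E p \<and> l \<in> L}"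
    using assms(1,2) pos mono by (intro koethe_ball_cover[where F = "{}"]) (auto intro: less_imp_le)
  then show "{t. t > 0 \<and> (\<exists>L \<subseteq> points ?E. subspace_dim_le seq_scale L n \<and>
      unit_ball ?E q \<subseteq> {seq_scale (of_real t) u + l | u l. u \<in> unit_ball ?E p \<and> l \<in> L})} \<noteq> {}"
    using zero_less_one by blast
  fix r assume "r \<in> {t. t > 0 \<and> (\<exists>L \<subseteq> points ?E. subspace_dim_le seq_scale L n \<and>
      unit_ball ?E q \<subseteq> {seq_scale (of_real t) u + l | u l. u \<in> unit_ball ?E p \<and> l \<in> L})}"
  then obtain L where "r > 0" and dim: "subspace_dim_le seq_scale L n"
    and cover: "unit_ball ?E q \<subseteq> {seq_scale (of_real r) u + l | u l. u \<in> unit_ball ?E p \<and> l \<in> L}"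
    by blast
  obtain B where B: "finite B" "card B \<le> n" "V.span B = L"
    using dim unfolding subspace_dim_le_def by blast
  obtain \<phi> where \<phi>: "\<exists>i\<in>F. \<phi> i \<noteq> 0" "\<And>b. b \<in> B \<Longrightarrow> (\<Sum>i\<in>F. \<phi> i * b i) = 0"
    using underdetermined_linear_system[OF B(1) F(1), of "\<lambda>b. b"] B(2) F(3) by auto
  have "(\<Sum>i\<in>F. \<phi> i * seq_scale c l i) = c * (\<Sum>i\<in>F. \<phi> i * l i)" for c l
    unfolding sum_distrib_left by (intro sum.cong) (auto simp: seq_scale_def)
  then have "V.subspace {l. (\<Sum>i\<in>F. \<phi> i * l i) = 0}"
    by (auto simp: V.subspace_def distrib_left sum.distrib)
  then have \<phi>L: "(\<Sum>i\<in>F. \<phi> i * l i) = 0" if "l \<in> L" for l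
    using V.span_minimal[of B "{l. (\<Sum>i\<in>F. \<phi> i * l i) = 0}"] \<phi>(2) B(3) that by blast
  have "F \<noteq> {}" using F by auto
  define D where "D = Max ((\<lambda>i. norm (\<phi> i) / a p i) ` F)"
  have D: "norm (\<phi> i) \<le> D * a p i" if "i \<in> F" for i
  proof -
    have "norm (\<phi> i) / a p i \<le> D" unfolding D_def using that F(1) by (intro Max_ge) auto
    then show ?thesis using pos[of i p] that F(2) by (auto simp: field_simps)
  qed
  have "D \<in> (\<lambda>i. norm (\<phi> i) / a p i) ` F"
    unfolding D_def using F(1) \<open>F \<noteq> {}\<close> by (intro Max_in) auto
  then obtain m where m: "m \<in> F" "D = norm (\<phi> m) / a p m" by auto
  then have "m \<ge> n0" using F(2) by auto
  have "D > 0"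
  proof -
    obtain i where i: "i \<in> F" "\<phi> i \<noteq> 0" using \<phi>(1) by blast
    then have "0 < D * a p i" using D[of i] zero_less_norm_iff[of "\<phi> i"] by linarith
    then show ?thesis using pos[of i p] i F(2) by (auto simp: zero_less_mult_iff)
  qed
  define x where "x = (\<lambda>i. if i = m then of_real (1 / a q m) else 0 :: 'k)"
  have "(\<Sum>\<^sub>\<infinity>i\<in>{n0..}. norm (x i) * a q i) = (\<Sum>\<^sub>\<infinity>i\<in>{m}. norm (x i) * a q i)"
    using \<open>m \<ge> n0\<close> by (intro infsum_cong_neutral) (auto simp: x_def)
  also have "\<dots> = 1"
    using pos[OF \<open>m \<ge> n0\<close>, of q] by (simp add: x_def norm_divide)
  finally have "x \<in> unit_ball ?E q"
    using finite_support_in_points[of "{m}" n0 x a] \<open>m \<ge> n0\<close>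
    by (auto simp: unit_ball_def seminorm_koethe_space x_def)
  then obtain u l where ul: "x = seq_scale (of_real r) u + l" "u \<in> unit_ball ?E p" "l \<in> L"
    using cover by blast
  have "(\<Sum>i\<in>F. \<phi> i * x i) = (\<Sum>i\<in>F. of_real r * (\<phi> i * u i)) + (\<Sum>i\<in>F. \<phi> i * l i)"
    unfolding sum.distrib[symmetric] ul(1) by (intro sum.cong) (auto simp: seq_scale_def algebra_simps)
  also have "\<dots> = of_real r * (\<Sum>i\<in>F. \<phi> i * u i)"
    using \<phi>L[OF ul(3)] by (simp add: sum_distrib_left)
  finally have "of_real r * (\<Sum>i\<in>F. \<phi> i * u i) = (\<Sum>i\<in>F. \<phi> i * x i)" ..
  also have "\<dots> = (\<Sum>i\<in>F. if i = m then \<phi> i * of_real (1 / a q m) else 0)"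
    by (intro sum.cong) (auto simp: x_def)
  also have "\<dots> = \<phi> m * of_real (1 / a q m)"
    using F(1) m(1) by simp
  finally have "norm (\<phi> m * of_real (1 / a q m)) = norm (of_real r * (\<Sum>i\<in>F. \<phi> i * u i))" by simp
  then have "norm (\<phi> m) / a q m = r * norm (\<Sum>i\<in>F. \<phi> i * u i)"
    using \<open>r > 0\<close> pos[OF \<open>m \<ge> n0\<close>, of q] by (simp add: norm_mult norm_divide)
  also have "norm (\<Sum>i\<in>F. \<phi> i * u i) \<le> D"
  proof -
    have "norm (\<Sum>i\<in>F. \<phi> i * u i) \<le> (\<Sum>i\<in>F. norm (\<phi> i) * norm (u i))"
      using norm_sum[of "\<lambda>i. \<phi> i * u i" F] by (simp add: norm_mult)
    also have "\<dots> \<le> (\<Sum>i\<in>F. (D * a p i) * norm (u i))"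
      by (intro sum_mono mult_right_mono D) auto
    also have "\<dots> = D * (\<Sum>i\<in>F. norm (u i) * a p i)"
      by (simp add: sum_distrib_left mult_ac)
    also have "(\<Sum>i\<in>F. norm (u i) * a p i) \<le> (\<Sum>\<^sub>\<infinity>i\<in>{n0..}. norm (u i) * a p i)"
      using ul(2) \<open>p \<ge> 1\<close> F(1,2) pos
      by (intro finite_sum_le_infsum) (auto simp: unit_ball_def koethe_space_def less_imp_le)
    also have "\<dots> \<le> 1"
      using ul(2) by (auto simp: unit_ball_def seminorm_koethe_space)
    finally show ?thesis using \<open>D > 0\<close> by simp
  qed
  finally have "norm (\<phi> m) / a q m \<le> r * D" using \<open>r > 0\<close> by simp
  then have "D * (a p m / a q m) \<le> D * r"
    using m(2) pos[OF \<open>m \<ge> n0\<close>, of p] by (simp add: mult_ac)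
  then have "a p m / a q m \<le> r" using \<open>D > 0\<close> mult_le_cancel_left_pos by blast
  moreover have "t \<le> a p m / a q m"
    using ge[OF m(1)] pos[OF \<open>m \<ge> n0\<close>, of q] by (simp add: field_simps)
  ultimately show "t \<le> r" by linarith
qed

section \<open>Power series spaces of finite type\<close>

lemma Lambda1_diameter:
  assumes "mono \<beta>" "\<And>n. \<beta> n \<ge> 0" "p \<ge> 1" "p < q"
  shows "koethe_diameter (Lambda1 0 \<beta> :: (nat \<Rightarrow> 'k::real_normed_field) graded_space) n q p
           = exp (- ((1 / real p - 1 / real q) * \<beta> n))"
    (is "?d = exp (- (?\<epsilon> * _))")
proof (rule antisym)
  have "?\<epsilon> \<ge> 0" using assms by (simp add: field_simps)
  have quotient: "exp (- \<beta> i / real p) = exp (- (?\<epsilon> * \<beta> i)) * exp (- \<beta> i / real q)" for i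
    by (simp flip: exp_add add: field_simps)
  show "?d \<le> exp (- (?\<epsilon> * \<beta> n))"
    unfolding Lambda1_def
  proof (rule koethe_diameter_le[where F = "{..<n}"])
    fix i assume "i \<notin> {..<n}"
    then show "exp (- \<beta> i / real p) \<le> exp (- (?\<epsilon> * \<beta> n)) * exp (- \<beta> i / real q)"
      unfolding quotient using \<open>?\<epsilon> \<ge> 0\<close> monoD[OF assms(1), of n i] by (simp add: mult_left_mono)
  qed (use assms in auto)
  show "exp (- (?\<epsilon> * \<beta> n)) \<le> ?d"
    unfolding Lambda1_def
  proof (rule koethe_diameter_ge[where F = "{..n}"])
    show "exp (- \<beta> i / real p) \<le> exp (- \<beta> i / real q)" for i
      unfolding quotient[of i] using \<open>?\<epsilon> \<ge> 0\<close> assms(2)[of i] by simp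
    fix i assume "i \<in> {..n}"
    then show "exp (- (?\<epsilon> * \<beta> n)) * exp (- \<beta> i / real q) \<le> exp (- \<beta> i / real p)"
      unfolding quotient using \<open>?\<epsilon> \<ge> 0\<close> monoD[OF assms(1), of i n] by (simp add: mult_left_mono)
  qed (use assms in auto)
qed

section \<open>The diameters of \<open>\<K>\<^sub>\<alpha>\<close>\<close>

lemma K_weight_pos: "K_weight \<alpha> k i > 0"
  by (simp add: K_weight_def)

lemma K_weight_quotient:
  assumes "p < q"
  shows "K_weight \<alpha> p i =
    exp (- ((1 / real p - 1 / real q + (if block_of i \<in> {p..<q} then 1 else 0)) * \<alpha> i)) * K_weight \<alpha> q i"
  using assms by (auto simp: K_weight_def algebra_simps simp flip: exp_add)

lemma K_weight_quotient_bounds: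
  assumes "p \<ge> 1" "p < q" "\<alpha> i \<ge> 0"
  shows "K_weight \<alpha> p i \<le> exp (- ((1 / real p - 1 / real q) * \<alpha> i)) * K_weight \<alpha> q i"
    and "exp (- (2 * \<alpha> i)) * K_weight \<alpha> q i \<le> K_weight \<alpha> p i"
    and "K_weight \<alpha> p i \<le> K_weight \<alpha> q i"
proof -
  let ?\<epsilon> = "1 / real p - 1 / real q"
  let ?\<delta> = "if block_of i \<in> {p..<q} then 1 else 0 :: real"
  have "1 / real p \<le> 1" "1 / real q \<ge> 0" using assms by auto
  then have "?\<epsilon> \<le> 1" by linarith
  have "?\<epsilon> \<ge> 0" using assms by (simp add: field_simps)
  have "?\<epsilon> * \<alpha> i \<le> (?\<epsilon> + ?\<delta>) * \<alpha> i" "(?\<epsilon> + ?\<delta>) * \<alpha> i \<le> 2 * \<alpha> i" "0 \<le> (?\<epsilon> + ?\<delta>) * \<alpha> i"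
    using assms(3) \<open>?\<epsilon> \<ge> 0\<close> \<open>?\<epsilon> \<le> 1\<close> by (auto intro!: mult_right_mono)
  then show "K_weight \<alpha> p i \<le> exp (- (?\<epsilon> * \<alpha> i)) * K_weight \<alpha> q i"
    and "exp (- (2 * \<alpha> i)) * K_weight \<alpha> q i \<le> K_weight \<alpha> p i"
    and "K_weight \<alpha> p i \<le> K_weight \<alpha> q i"
    unfolding K_weight_quotient[OF assms(2), of \<alpha> i] using K_weight_pos[of \<alpha> q i] by auto
qed

lemma K_space_diameter_le:
  assumes mono: "mono_on {1..} \<alpha>" and pos: "\<And>n. n \<ge> 1 \<Longrightarrow> \<alpha> n > 0" and "p \<ge> 1" "p < q"
  shows "koethe_diameter (K_space \<alpha> :: (nat \<Rightarrow> 'k::real_normed_field) graded_space) n q p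
           \<le> exp (- ((1 / real p - 1 / real q) * \<alpha> (n + 1)))"
    (is "_ \<le> exp (- (?\<epsilon> * _))")
  unfolding K_space_def
proof (rule koethe_diameter_le[where F = "{1..n}"])
  have "?\<epsilon> \<ge> 0" using assms by (simp add: field_simps)
  fix i :: nat assume i: "i \<ge> 1" "i \<notin> {1..n}"
  have "K_weight \<alpha> p i \<le> exp (- (?\<epsilon> * \<alpha> i)) * K_weight \<alpha> q i"
    using K_weight_quotient_bounds(1)[OF assms(3,4)] pos[OF i(1)] by simp
  also have "\<alpha> (n + 1) \<le> \<alpha> i" using i by (intro mono_onD[OF mono]) auto
  then have "exp (- (?\<epsilon> * \<alpha> i)) * K_weight \<alpha> q i \<le> exp (- (?\<epsilon> * \<alpha> (n + 1))) * K_weight \<alpha> q i"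
    using \<open>?\<epsilon> \<ge> 0\<close> K_weight_pos[of \<alpha> q i] by (intro mult_right_mono) (auto intro: mult_left_mono)
  finally show "K_weight \<alpha> p i \<le> exp (- (?\<epsilon> * \<alpha> (n + 1))) * K_weight \<alpha> q i" .
qed (use assms K_weight_pos in \<open>auto intro: less_imp_le\<close>)

lemma K_space_diameter_nonneg:
  assumes "\<And>n. n \<ge> 1 \<Longrightarrow> \<alpha> n > 0" "p \<ge> 1" "p < q"
  shows "0 \<le> koethe_diameter (K_space \<alpha> :: (nat \<Rightarrow> 'k::real_normed_field) graded_space) n q p"
  unfolding K_space_def
proof (rule koethe_diameter_ge[where F = "{1..n + 1}"])
  show "K_weight \<alpha> p i \<le> K_weight \<alpha> q i" if "i \<ge> 1" for i
    using K_weight_quotient_bounds(3)[OF assms(2,3)] assms(1)[OF that] by simp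
qed (use assms K_weight_pos in \<open>auto intro: less_imp_le\<close>)

text \<open>
  Instability makes \<open>\<epsilon> \<alpha>\<^sub>n\<^sub>+\<^sub>1 \<ge> 2 \<alpha>\<^sub>n\<close> for large \<open>n\<close>, so that each of the first \<open>n\<close> quotients
  of the weights is at least \<open>exp (- \<epsilon> \<alpha>\<^sub>n\<^sub>+\<^sub>1)\<close>, even in the blocks with the additional factor.
\<close>

lemma K_space_diameter_ge:
  assumes mono: "mono_on {1..} \<alpha>" and pos: "\<And>n. n \<ge> 1 \<Longrightarrow> \<alpha> n > 0" and "unstable \<alpha>"
    and "p \<ge> 1" "p < q"
  shows "\<forall>\<^sub>F n in sequentially. block_of (n + 1) \<notin> {p..<q} \<longrightarrow>
      exp (- ((1 / real p - 1 / real q) * \<alpha> (n + 1)))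
        \<le> koethe_diameter (K_space \<alpha> :: (nat \<Rightarrow> 'k::real_normed_field) graded_space) n q p"
proof -
  define \<epsilon> where "\<epsilon> = 1 / real p - 1 / real q"
  have "\<epsilon> > 0" using assms by (simp add: \<epsilon>_def field_simps)
  have "\<forall>\<^sub>F n in sequentially. 2 / \<epsilon> \<le> \<alpha> (n + 1) / \<alpha> n"
    using \<open>unstable \<alpha>\<close> unfolding unstable_def filterlim_at_top by blast
  then show ?thesis
    using eventually_ge_at_top[of 1]
  proof eventually_elim
    case (elim n)
    have step: "2 * \<alpha> n \<le> \<epsilon> * \<alpha> (n + 1)"
      using elim \<open>\<epsilon> > 0\<close> pos[of n] by (simp add: field_simps)
    show ?case
      unfolding K_space_def \<epsilon>_def[symmetric]
    proof (intro impI koethe_diameter_ge[where F = "{1..n + 1}"])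
      show "K_weight \<alpha> p i \<le> K_weight \<alpha> q i" if "i \<ge> 1" for i
        using K_weight_quotient_bounds(3)[OF assms(4,5)] pos[OF that] by simp
      fix i assume block: "block_of (n + 1) \<notin> {p..<q}" and i: "i \<in> {1..n + 1}"
      show "exp (- (\<epsilon> * \<alpha> (n + 1))) * K_weight \<alpha> q i \<le> K_weight \<alpha> p i"
      proof (cases "i = n + 1")
        case True
        then show ?thesis
          using block unfolding K_weight_quotient[OF \<open>p < q\<close>, of \<alpha> i] by (auto simp: \<epsilon>_def)
      next
        case False
        then have "\<alpha> i \<le> \<alpha> n" using i elim(2) by (intro mono_onD[OF mono]) auto
        then have "exp (- (\<epsilon> * \<alpha> (n + 1))) * K_weight \<alpha> q i \<le> exp (- (2 * \<alpha> i)) * K_weight \<alpha> q i"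
          using step K_weight_pos[of \<alpha> q i] by (intro mult_right_mono) auto
        also have "\<dots> \<le> K_weight \<alpha> p i"
          using K_weight_quotient_bounds(2)[OF assms(4,5)] pos[of i] i by simp
        finally show ?thesis .
      qed
    qed (use assms K_weight_pos in auto)
  qed
qed

section \<open>Equality of the diametral dimensions\<close>

theorem proposition3p6:
  fixes \<alpha> :: "nat \<Rightarrow> real"
  assumes "strict_mono_on {1..} \<alpha>"
    and "\<And>n. n \<ge> 1 \<Longrightarrow> \<alpha> n > 0"
    and "nuclear seq_scale (Lambda1 1 \<alpha> :: (nat \<Rightarrow> 'k::{real_normed_field, banach}) graded_space)"
    and "unstable \<alpha>"
  shows "diametral_dimension seq_scale (K_space \<alpha> :: (nat \<Rightarrow> 'k) graded_space) =
    diametral_dimension seq_scale (Lambda1 0 (\<lambda>n. \<alpha> (n + 1)) :: (nat \<Rightarrow> 'k) graded_space)"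
proof -
  define dK where "dK = (\<lambda>q p n. koethe_diameter (K_space \<alpha> :: (nat \<Rightarrow> 'k) graded_space) n q p)"
  define dL where
    "dL = (\<lambda>q p n. koethe_diameter (Lambda1 0 (\<lambda>n. \<alpha> (n + 1)) :: (nat \<Rightarrow> 'k) graded_space) n q p)"
  have mono: "mono_on {1..} \<alpha>"
    using assms(1) by (rule strict_mono_on_imp_mono_on)
  then have "mono (\<lambda>n. \<alpha> (n + 1))"
    by (auto simp: mono_def mono_on_def)
  then have dL_eq: "dL q p n = exp (- ((1 / real p - 1 / real q) * \<alpha> (n + 1)))"
    if "p \<ge> 1" "p < q" for p q n
    unfolding dL_def using that assms(2) by (intro Lambda1_diameter) (auto intro: less_imp_le)
  have dK_nonneg: "0 \<le> dK q p n" if "p \<ge> 1" "p < q" for p q n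
    unfolding dK_def using assms(2) that by (rule K_space_diameter_nonneg)
  have dK_le: "dK q p n \<le> dL q p n" if "p \<ge> 1" "p < q" for p q n
    unfolding dL_eq[OF that] unfolding dK_def using mono assms(2) that by (rule K_space_diameter_le)
  have dL_le: "\<forall>\<^sub>F n in sequentially. dL r p n \<le> dK q p n + dK r q n"
    if "p \<ge> 1" "p < q" "q < r" for p q r
  proof -
    have "q \<ge> 1" "p < r" using that by auto
    have "\<forall>\<^sub>F n in sequentially. block_of (n + 1) \<notin> {p..<q} \<longrightarrow>
        exp (- ((1 / real p - 1 / real q) * \<alpha> (n + 1))) \<le> dK q p n"
      unfolding dK_def by (rule K_space_diameter_ge[OF mono assms(2,4) that(1,2)])
    moreover have "\<forall>\<^sub>F n in sequentially. block_of (n + 1) \<notin> {q..<r} \<longrightarrow>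
        exp (- ((1 / real q - 1 / real r) * \<alpha> (n + 1))) \<le> dK r q n"
      unfolding dK_def by (rule K_space_diameter_ge[OF mono assms(2,4) \<open>q \<ge> 1\<close> that(3)])
    ultimately show ?thesis
    proof eventually_elim
      case (elim n)
      \<comment> \<open>Both exponents \<open>1/p - 1/q\<close> and \<open>1/q - 1/r\<close> are at most \<open>1/p - 1/r\<close>.\<close>
      have "1 / real r \<le> 1 / real q" "1 / real q \<le> 1 / real p"
        using that by (auto simp: field_simps)
      then have "dL r p n \<le> exp (- ((1 / real p - 1 / real q) * \<alpha> (n + 1)))"
        "dL r p n \<le> exp (- ((1 / real q - 1 / real r) * \<alpha> (n + 1)))"
        unfolding dL_eq[OF that(1) \<open>p < r\<close>]
        using assms(2)[of "n + 1"] by (auto intro!: mult_right_mono)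
      moreover have "block_of (n + 1) \<notin> {p..<q} \<or> block_of (n + 1) \<notin> {q..<r}" by auto
      ultimately show ?case
        using elim dK_nonneg[OF that(1,2), of n] dK_nonneg[OF \<open>q \<ge> 1\<close> that(3), of n] by force
    qed
  qed
  have K_iff: "t \<in> diametral_dimension seq_scale (K_space \<alpha> :: (nat \<Rightarrow> 'k) graded_space) \<longleftrightarrow>
      (\<forall>p\<ge>1. \<exists>q>p. (\<lambda>n. t n * of_real (dK q p n)) \<longlonglongrightarrow> 0)" for t
    by (simp add: diametral_dimension_def dK_def)
  have L_iff: "t \<in> diametral_dimension seq_scale (Lambda1 0 (\<lambda>n. \<alpha> (n + 1)) :: (nat \<Rightarrow> 'k) graded_space) \<longleftrightarrow>
      (\<forall>p\<ge>1. \<exists>q>p. (\<lambda>n. t n * of_real (dL q p n)) \<longlonglongrightarrow> 0)" for t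
    by (simp add: diametral_dimension_def dL_def)
  show ?thesis
  proof (intro equalityI subsetI)
    fix t :: "nat \<Rightarrow> 'k"
    assume t: "t \<in> diametral_dimension seq_scale (K_space \<alpha>)"
    show "t \<in> diametral_dimension seq_scale (Lambda1 0 (\<lambda>n. \<alpha> (n + 1)))"
      unfolding L_iff
    proof (intro allI impI)
      fix p :: nat assume "p \<ge> 1"
      then obtain q where q: "q > p" "(\<lambda>n. t n * of_real (dK q p n)) \<longlonglongrightarrow> 0"
        using t unfolding K_iff by blast
      then have "q \<ge> 1" by auto
      then obtain r where r: "r > q" "(\<lambda>n. t n * of_real (dK r q n)) \<longlonglongrightarrow> 0"
        using t unfolding K_iff by blast
      have "(\<lambda>n. t n * of_real (dK q p n + dK r q n)) \<longlonglongrightarrow> 0"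
        using tendsto_add[OF q(2) r(2)] by (simp add: distrib_left)
      moreover have "\<forall>\<^sub>F n in sequentially.
          norm (t n * of_real (dL r p n)) \<le> norm (t n * of_real (dK q p n + dK r q n))"
        using dL_le[OF \<open>p \<ge> 1\<close> q(1) r(1)]
      proof eventually_elim
        case (elim n)
        have "0 \<le> dL r p n" using dL_eq[of p r n] \<open>p \<ge> 1\<close> q(1) r(1) by simp
        then have "\<bar>dL r p n\<bar> \<le> \<bar>dK q p n + dK r q n\<bar>" using elim by linarith
        then show ?case
          unfolding norm_mult norm_of_real by (intro mult_left_mono) auto
      qed
      ultimately have "(\<lambda>n. t n * of_real (dL r p n)) \<longlonglongrightarrow> 0"
        by (rule Lim_null_comparison[OF _ tendsto_norm_zero, rotated])
      then show "\<exists>q>p. (\<lambda>n. t n * of_real (dL q p n)) \<longlonglongrightarrow> 0"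
        using q(1) r(1) less_trans by blast
    qed
  next
    fix t :: "nat \<Rightarrow> 'k"
    assume t: "t \<in> diametral_dimension seq_scale (Lambda1 0 (\<lambda>n. \<alpha> (n + 1)))"
    show "t \<in> diametral_dimension seq_scale (K_space \<alpha>)"
      unfolding K_iff
    proof (intro allI impI)
      fix p :: nat assume "p \<ge> 1"
      then obtain q where q: "q > p" "(\<lambda>n. t n * of_real (dL q p n)) \<longlonglongrightarrow> 0"
        using t unfolding L_iff by blast
      have "norm (t n * of_real (dK q p n)) \<le> norm (t n * of_real (dL q p n))" for n
        unfolding norm_mult norm_of_real
        using dK_nonneg[OF \<open>p \<ge> 1\<close> q(1), of n] dK_le[OF \<open>p \<ge> 1\<close> q(1), of n]
        by (intro mult_left_mono) auto
      then have "(\<lambda>n. t n * of_real (dK q p n)) \<longlonglongrightarrow> 0"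
        by (rule Lim_null_comparison[OF always_eventually[OF allI] tendsto_norm_zero[OF q(2)]])
      then show "\<exists>q>p. (\<lambda>n. t n * of_real (dK q p n)) \<longlonglongrightarrow> 0"
        using q(1) by blast
    qed
  qed
qed

end
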